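(* Every finite lattice is a homomorphic image of some sublattice of the lattice $\mathbf{OC}$ of all overcommutative varieties of monoids. That is, for every finite lattice $L$ there exist a sublattice $S$ of $\mathbf{OC}$ and a surjective lattice homomorphism $S\to L$.
   Context: A monoid is regarded as an algebra with two operations: an associative binary operation and a 0-ary operation that fixes the neutral element. A variety of monoids is a class of monoids defined by a set of identities in this signature; the varieties of monoids form a lattice $\mathbf{MON}$ under inclusion. A variety of monoids is called overcommutative if it contains the variety of all commutative monoids. The overcommutative monoid varieties form a sublattice of $\mathbf{MON}$, denoted by $\mathbf{OC}$. *)

theory Defs
  imports "HOL-Algebra.Group" "HOL-Library.Countable_Set"
begin

section \<open>Identities and varieties of monoids\<close>

text \<open>
  An identity in the signature of monoids is a pair of words over a countably infinite
  alphabet, here the natural numbers; the empty word is the constant.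
\<close>

type_synonym identity = "nat list \<times> nat list"

definition word_value :: "('u, 'm) monoid_scheme \<Rightarrow> (nat \<Rightarrow> 'u) \<Rightarrow> nat list \<Rightarrow> 'u"
  where "word_value M \<phi> w = foldr (\<otimes>\<^bsub>M\<^esub>) (map \<phi> w) \<one>\<^bsub>M\<^esub>"

definition satisfies :: "('u, 'm) monoid_scheme \<Rightarrow> identity \<Rightarrow> bool"
  where "satisfies M e \<longleftrightarrow>
    (\<forall>\<phi>. range \<phi> \<subseteq> carrier M \<longrightarrow> word_value M \<phi> (fst e) = word_value M \<phi> (snd e))"

text \<open>
  HOL has no class of all monoids, so classes of monoids are taken relative to a universe
  \<open>'u\<close>, which contributes the monoids whose carrier is any subset of \<open>'u\<close>. The fact
  \<open>models_subset_universe\<close> below shows that inclusion between varieties does not depend on the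
  universe, as long as it is infinite.
\<close>

definition models :: "identity set \<Rightarrow> 'u monoid set"
  where "models \<Sigma> = {M. monoid M \<and> (\<forall>e\<in>\<Sigma>. satisfies M e)}"

definition monoid_variety :: "'u monoid set \<Rightarrow> bool"
  where "monoid_variety V \<longleftrightarrow> (\<exists>\<Sigma>. V = models \<Sigma>)"

definition overcommutative :: "'u monoid set \<Rightarrow> bool"
  where "overcommutative V \<longleftrightarrow> {M. comm_monoid M} \<subseteq> V"

definition MON :: "'u monoid set gorder"
  where "MON = \<lparr>carrier = {V. monoid_variety V}, eq = (=), le = (\<subseteq>)\<rparr>"

definition OC :: "'u monoid set gorder"
  where "OC = MON\<lparr>carrier := {V \<in> carrier MON. overcommutative V}\<rparr>"


section \<open>Sublattices and homomorphisms\<close>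

definition sublattice :: "'a set \<Rightarrow> ('a, 'm) gorder_scheme \<Rightarrow> bool"
  where "sublattice S L \<longleftrightarrow> S \<noteq> {} \<and> S \<subseteq> carrier L \<and>
    (\<forall>x\<in>S. \<forall>y\<in>S. x \<squnion>\<^bsub>L\<^esub> y \<in> S \<and> x \<sqinter>\<^bsub>L\<^esub> y \<in> S)"

definition lattice_hom :: "('a, 'm) gorder_scheme \<Rightarrow> ('b, 'n) gorder_scheme \<Rightarrow> ('a \<Rightarrow> 'b) \<Rightarrow> bool"
  where "lattice_hom K L h \<longleftrightarrow>
    h \<in> carrier K \<rightarrow> carrier L \<and> join_pres K L h \<and> meet_pres K L h"


section \<open>Basic facts\<close>

lemma MON_simps [simp]:
  "carrier MON = {V. monoid_variety V}" "V .=\<^bsub>MON\<^esub> W \<longleftrightarrow> V = W" "V \<sqsubseteq>\<^bsub>MON\<^esub> W \<longleftrightarrow> V \<subseteq> W"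
  by (simp_all add: MON_def)

lemma OC_simps [simp]:
  "carrier OC = {V. monoid_variety V \<and> overcommutative V}"
  "V .=\<^bsub>OC\<^esub> W \<longleftrightarrow> V = W" "V \<sqsubseteq>\<^bsub>OC\<^esub> W \<longleftrightarrow> V \<subseteq> W"
  by (simp_all add: OC_def MON_def)

lemma word_value_simps [simp]:
  "word_value M \<phi> [] = \<one>\<^bsub>M\<^esub>"
  "word_value M \<phi> (x # w) = \<phi> x \<otimes>\<^bsub>M\<^esub> word_value M \<phi> w"
  by (simp_all add: word_value_def)

lemma (in monoid) word_value_closed [intro, simp]:
  "range \<phi> \<subseteq> carrier G \<Longrightarrow> word_value G \<phi> w \<in> carrier G"
  by (induction w) auto

lemma (in monoid) word_value_append:
  "range \<phi> \<subseteq> carrier G \<Longrightarrow>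
    word_value G \<phi> (v @ w) = word_value G \<phi> v \<otimes> word_value G \<phi> w"
proof (induction v)
  case (Cons x v)
  moreover have "\<phi> x \<in> carrier G" using Cons.prems by auto
  ultimately show ?case by (simp add: m_assoc)
qed auto

lemma models_subset_universe:
  assumes inf: "infinite (UNIV :: 'u set)"
    and sub: "models \<Sigma> \<subseteq> (models \<Sigma>' :: 'u monoid set)"
  shows "models \<Sigma> \<subseteq> (models \<Sigma>' :: 'w monoid set)"
proof
  fix M :: "'w monoid" assume M: "M \<in> models \<Sigma>"
  then interpret M: monoid M by (simp add: models_def)
  have "satisfies M e" if e: "e \<in> \<Sigma>'" for e
    unfolding satisfies_def
  proof (intro allI impI)
    fix \<phi> :: "nat \<Rightarrow> 'w" assume \<phi>: "range \<phi> \<subseteq> carrier M"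
    define N where "N = range (word_value M \<phi>)"
    have N_sub: "N \<subseteq> carrier M" using \<phi> by (auto simp: N_def)
    have N_one: "\<one>\<^bsub>M\<^esub> \<in> N"
      unfolding N_def by (rule range_eqI[of _ _ "[]"]) simp
    have N_mult: "a \<otimes>\<^bsub>M\<^esub> b \<in> N" if "a \<in> N" "b \<in> N" for a b
      using that \<phi> by (auto simp: N_def M.word_value_append[symmetric])
    have N_gen: "\<phi> x \<in> N" for x
    proof -
      have "\<phi> x \<in> carrier M" using \<phi> by auto
      then show ?thesis unfolding N_def by (intro range_eqI[of _ _ "[x]"]) simp
    qed
    have "countable N" by (simp add: N_def)
    then obtain f :: "'w \<Rightarrow> nat" where f: "inj_on f N" by (auto simp: countable_def)
    obtain k :: "nat \<Rightarrow> 'u" where k: "inj k"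
      using inf infinite_iff_countable_subset[of "UNIV :: 'u set"] by auto
    define g where "g = k \<circ> f"
    have g: "inj_on g N"
      unfolding g_def using f k by (meson comp_inj_on inj_on_subset subset_UNIV)
    define r where "r = inv_into N g"
    have rg [simp]: "r (g a) = a" if "a \<in> N" for a
      using that g by (simp add: r_def)
    define P where "P = \<lparr>carrier = g ` N, mult = (\<lambda>a b. g (r a \<otimes>\<^bsub>M\<^esub> r b)), one = g \<one>\<^bsub>M\<^esub>\<rparr>"
    have N_carr: "a \<in> carrier M" if "a \<in> N" for a using that N_sub by auto
    have P: "monoid P"
      by (rule monoidI) (auto simp: P_def N_one N_mult N_carr M.m_assoc)
    have trans: "word_value P (g \<circ> \<psi>) w = g (word_value M \<psi> w) \<and> word_value M \<psi> w \<in> N"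
      if "range \<psi> \<subseteq> N" for \<psi> w
    proof (induction w)
      case Nil
      then show ?case by (simp add: P_def N_one)
    next
      case (Cons x w)
      moreover have "\<psi> x \<in> N" using that by auto
      ultimately show ?case by (simp add: P_def N_mult)
    qed
    have "satisfies P d" if d: "d \<in> \<Sigma>" for d
      unfolding satisfies_def
    proof (intro allI impI)
      fix \<psi> :: "nat \<Rightarrow> 'u" assume \<psi>: "range \<psi> \<subseteq> carrier P"
      then have \<psi>N: "\<psi> x \<in> g ` N" for x by (auto simp: P_def)
      have rN: "range (r \<circ> \<psi>) \<subseteq> N"
      proof clarsimp
        fix x show "r (\<psi> x) \<in> N" using \<psi>N[of x] by auto
      qed
      have "g (r (\<psi> x)) = \<psi> x" for x
        using \<psi>N[of x] by auto
      then have eq: "g \<circ> (r \<circ> \<psi>) = \<psi>" by auto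
      have "satisfies M d" using M d by (simp add: models_def)
      moreover have "range (r \<circ> \<psi>) \<subseteq> carrier M" using rN N_sub by blast
      ultimately have "word_value M (r \<circ> \<psi>) (fst d) = word_value M (r \<circ> \<psi>) (snd d)"
        unfolding satisfies_def by blast
      then show "word_value P \<psi> (fst d) = word_value P \<psi> (snd d)"
        using trans[OF rN, of "fst d"] trans[OF rN, of "snd d"] eq by simp
    qed
    with P have "P \<in> models \<Sigma>" by (simp add: models_def)
    then have "satisfies P e" using sub e by (auto simp: models_def)
    moreover have "range (g \<circ> \<phi>) \<subseteq> carrier P" using N_gen by (auto simp: P_def)
    ultimately have "word_value P (g \<circ> \<phi>) (fst e) = word_value P (g \<circ> \<phi>) (snd e)"
      unfolding satisfies_def by blast
    moreover have "range \<phi> \<subseteq> N" using N_gen by auto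
    ultimately have "g (word_value M \<phi> (fst e)) = g (word_value M \<phi> (snd e))"
      using trans by metis
    then show "word_value M \<phi> (fst e) = word_value M \<phi> (snd e)"
      by (metis N_def rangeI rg)
  qed
  with M show "M \<in> models \<Sigma>'" by (simp add: models_def)
qed

lemma monoid_variety_Int:
  assumes "monoid_variety V" "monoid_variety W"
  shows "monoid_variety (V \<inter> W)"
proof -
  obtain \<Sigma> \<Sigma>' where "V = models \<Sigma>" "W = models \<Sigma>'"
    using assms by (auto simp: monoid_variety_def)
  then have "V \<inter> W = models (\<Sigma> \<union> \<Sigma>')" by (auto simp: models_def)
  then show ?thesis by (auto simp: monoid_variety_def)
qed

definition variety_join :: "'u monoid set \<Rightarrow> 'u monoid set \<Rightarrow> 'u monoid set"
  where "variety_join V W = models {e. \<forall>M\<in>V \<union> W. satisfies M e}"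

lemma variety_join_least:
  assumes "monoid_variety V" "monoid_variety W"
  shows "monoid_variety (variety_join V W)" "V \<union> W \<subseteq> variety_join V W"
    and "\<And>U. monoid_variety U \<Longrightarrow> V \<union> W \<subseteq> U \<Longrightarrow> variety_join V W \<subseteq> U"
proof -
  show "monoid_variety (variety_join V W)"
    by (auto simp: monoid_variety_def variety_join_def)
  show "V \<union> W \<subseteq> variety_join V W"
    using assms by (auto simp: monoid_variety_def variety_join_def models_def)
  fix U assume "monoid_variety U" and sub: "V \<union> W \<subseteq> U"
  then obtain \<Sigma> where U: "U = models \<Sigma>" by (auto simp: monoid_variety_def)
  then have "\<Sigma> \<subseteq> {e. \<forall>M\<in>V \<union> W. satisfies M e}" using sub by (auto simp: models_def)
  then show "variety_join V W \<subseteq> U" unfolding U variety_join_def models_def by blast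
qed

lemma MON_sup_inf:
  assumes "V \<in> carrier MON" "W \<in> carrier MON"
  shows "least MON (variety_join V W) (Upper MON {V, W})"
    and "greatest MON (V \<inter> W) (Lower MON {V, W})"
  using assms variety_join_least[of V W] monoid_variety_Int[of V W]
  by (auto simp: least_def greatest_def Upper_def Lower_def)

lemma OC_sup_inf:
  assumes "V \<in> carrier OC" "W \<in> carrier OC"
  shows "least OC (variety_join V W) (Upper OC {V, W})"
    and "greatest OC (V \<inter> W) (Lower OC {V, W})"
  using assms variety_join_least[of V W] monoid_variety_Int[of V W]
  by (auto simp: least_def greatest_def Upper_def Lower_def overcommutative_def)

lemma partial_order_MON: "partial_order MON"
  by unfold_locales (auto simp: fun_eq_iff)

lemma partial_order_OC: "partial_order OC"
  by unfold_locales (auto simp: fun_eq_iff)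

theorem lattice_MON: "lattice MON"
  by (intro lattice.intro upper_semilattice.intro lower_semilattice.intro
      upper_semilattice_axioms.intro lower_semilattice_axioms.intro partial_order_MON)
    (blast intro: MON_sup_inf)+

theorem lattice_OC: "lattice OC"
  by (intro lattice.intro upper_semilattice.intro lower_semilattice.intro
      upper_semilattice_axioms.intro lower_semilattice_axioms.intro partial_order_OC)
    (blast intro: OC_sup_inf)+

lemma MON_join_meet:
  assumes "V \<in> carrier MON" "W \<in> carrier MON"
  shows "V \<squnion>\<^bsub>MON\<^esub> W = variety_join V W" "V \<sqinter>\<^bsub>MON\<^esub> W = V \<inter> W"
proof -
  interpret lattice MON by (rule lattice_MON)
  show "V \<squnion>\<^bsub>MON\<^esub> W = variety_join V W"
    unfolding join_def sup_def
    by (rule some_equality) (use MON_sup_inf[OF assms] least_unique in blast)+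
  show "V \<sqinter>\<^bsub>MON\<^esub> W = V \<inter> W"
    unfolding meet_def inf_def
    by (rule some_equality) (use MON_sup_inf[OF assms] greatest_unique in blast)+
qed

lemma OC_join_meet:
  assumes "V \<in> carrier OC" "W \<in> carrier OC"
  shows "V \<squnion>\<^bsub>OC\<^esub> W = variety_join V W" "V \<sqinter>\<^bsub>OC\<^esub> W = V \<inter> W"
proof -
  interpret lattice OC by (rule lattice_OC)
  show "V \<squnion>\<^bsub>OC\<^esub> W = variety_join V W"
    unfolding join_def sup_def
    by (rule some_equality) (use OC_sup_inf[OF assms] least_unique in blast)+
  show "V \<sqinter>\<^bsub>OC\<^esub> W = V \<inter> W"
    unfolding meet_def inf_def
    by (rule some_equality) (use OC_sup_inf[OF assms] greatest_unique in blast)+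
qed

theorem sublattice_OC_MON: "sublattice (carrier OC) MON"
  unfolding sublattice_def
proof (intro conjI ballI)
  have "models {} \<in> carrier OC"
    by (auto simp: monoid_variety_def overcommutative_def models_def comm_monoid_def)
  then show "carrier OC \<noteq> {}" by blast
  show "carrier OC \<subseteq> carrier MON" by auto
  fix V W :: "'a monoid set" assume VW: "V \<in> carrier OC" "W \<in> carrier OC"
  then have VW': "V \<in> carrier MON" "W \<in> carrier MON" by auto
  interpret lattice OC by (rule lattice_OC)
  show "V \<squnion>\<^bsub>MON\<^esub> W \<in> carrier OC"
    unfolding MON_join_meet(1)[OF VW'] OC_join_meet(1)[OF VW, symmetric]
    by (rule join_closed[OF VW])
  show "V \<sqinter>\<^bsub>MON\<^esub> W \<in> carrier OC"
    unfolding MON_join_meet(2)[OF VW'] OC_join_meet(2)[OF VW, symmetric]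
    by (rule meet_closed[OF VW])
qed

end

theory Submission
  imports "HOL-Library.Nat_Bijection" "HOL-Library.Multiset" Defs
begin

text \<open>
  By Birkhoff's theorem the lattice of overcommutative varieties is dual to the lattice of fully
  invariant congruences on the free monoid whose pairs are balanced, that is, consist of words
  with the same letter counts (\<open>identities_models\<close>); intersections of varieties become joins of
  congruences (\<open>identities_Int\<close>). Hence it is enough to find a part of the congruence
  lattice that looks like a lattice of equivalence relations, and to represent the dual of \<open>L\<close> there.

  Write \<open>x\<close>, \<open>y\<close> for the letters 0, 1. For every level \<open>i\<close> take the \<open>i + 1\<close> words
  \<open>x\<^sup>k y x\<^sup>i\<^sup>+\<^sup>3 y x y x\<^sup>i\<^sup>-\<^sup>k\<close> with \<open>k \<le> i\<close>. All words of a level have the same letter counts, and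
  identifying words within levels never acts on a level word except by moving it inside its own
  level in the prescribed way (\<open>level_word_step\<close>). So a family of equivalence relations, one on
  each finite set \<open>{0..i}\<close>, can be prescribed freely and independently, and is recovered from
  the fully invariant congruence which it generates.

  The dual of \<open>L\<close> is represented by equivalence relations on the natural numbers by means of
  Jonsson's proof of Whitman's theorem: there is a distance function \<open>d\<close> on the naturals with
  values in \<open>L\<close>, satisfying \<open>d i j \<sqinter> d j k \<sqsubseteq> d i k\<close>, and so rich that \<open>a \<sqinter> b \<sqsubseteq> d k l\<close> always
  allows a walk from \<open>k\<close> to \<open>l\<close> with distances \<open>a\<close>, \<open>b\<close>, \<open>a\<close>, \<open>b\<close> (\<open>lattice_metric_exists\<close>).
  The relations \<open>a \<sqsubseteq> d k l\<close> then turn joins into intersections and meets into joins of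
  equivalence relations. Distances are stored as principal down-sets, for which meets are
  plain intersections.

  These equivalence relations live on an infinite set, whereas every level is finite. Therefore
  a variety is said to realise \<open>a\<close> if on each level it identifies only pairs with \<open>a \<sqsubseteq> d k l\<close>
  and each such pair is identified on all sufficiently high levels. The first half
  is preserved by chains of arbitrary length, the second needs only the walk of length four;
  thus realisation is compatible with joins and meets (\<open>realizes_join\<close>, \<open>realizes_meet\<close>). It
  determines \<open>a\<close>, and every \<open>a\<close> is realised. The varieties realising some element form the
  required sublattice, and the realised element is the value of the homomorphism. Passing to
  a homomorphic image, instead of an embedding, is what makes such approximation sufficient.
\<close>

section \<open>Identities of varieties\<close>

definition identities :: "'u monoid set \<Rightarrow> identity set"
  where "identities V = {e. \<forall>M\<in>V. satisfies M e}"

abbreviation subst :: "(nat \<Rightarrow> nat list) \<Rightarrow> nat list \<Rightarrow> nat list"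
  where "subst \<sigma> w \<equiv> concat (map \<sigma> w)"

lemma subst_subst: "subst \<tau> (subst \<sigma> w) = subst (\<lambda>x. subst \<tau> (\<sigma> x)) w"
  by (induction w) auto

definition fully_invariant_congruence :: "identity set \<Rightarrow> bool"
  where "fully_invariant_congruence E \<longleftrightarrow> equiv UNIV E \<and>
    (\<forall>p q u v. (u, v) \<in> E \<longrightarrow> (p @ u @ q, p @ v @ q) \<in> E) \<and>
    (\<forall>\<sigma> u v. (u, v) \<in> E \<longrightarrow> (subst \<sigma> u, subst \<sigma> v) \<in> E)"

lemma (in monoid) word_value_subst:
  assumes "range \<phi> \<subseteq> carrier G"
  shows "word_value G \<phi> (subst \<sigma> w) = word_value G (\<lambda>x. word_value G \<phi> (\<sigma> x)) w"
  by (induction w) (simp_all add: word_value_append[OF assms])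

lemma satisfies_context:
  assumes "monoid M" "satisfies M (u, v)"
  shows "satisfies M (p @ u @ q, p @ v @ q)"
proof -
  interpret monoid M by fact
  show ?thesis
    using assms(2) by (simp add: satisfies_def word_value_append)
qed

lemma satisfies_subst:
  fixes M :: "('a, 'm) monoid_scheme"
  assumes "monoid M" "satisfies M (u, v)"
  shows "satisfies M (subst \<sigma> u, subst \<sigma> v)"
  unfolding satisfies_def
proof (intro allI impI)
  interpret monoid M by fact
  fix \<phi> :: "nat \<Rightarrow> 'a" assume \<phi>: "range \<phi> \<subseteq> carrier M"
  then have "range (\<lambda>x. word_value M \<phi> (\<sigma> x)) \<subseteq> carrier M" by auto
  then show "word_value M \<phi> (fst (subst \<sigma> u, subst \<sigma> v)) = word_value M \<phi> (snd (subst \<sigma> u, subst \<sigma> v))"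
    using assms(2) by (simp add: satisfies_def word_value_subst[OF \<phi>])
qed

lemma fully_invariant_identities:
  assumes "\<And>M. M \<in> V \<Longrightarrow> monoid M"
  shows "fully_invariant_congruence (identities V)"
  unfolding fully_invariant_congruence_def
proof (intro conjI allI impI)
  show "equiv UNIV (identities V)"
    by (rule equivI)
      (auto simp: refl_on_def sym_def trans_def identities_def satisfies_def)
qed (auto simp: identities_def intro: satisfies_context satisfies_subst assms)

text \<open>
  Birkhoff's completeness theorem: the relatively free monoid satisfies no identities outside
  the congruence. It is realised on representatives of the congruence classes, so its carrier
  is a set of words rather than a subset of the given universe; since inclusion of varieties does not
  depend on the infinite universe, it can serve as a witness all the same.
\<close>

lemma identities_models:
  assumes inf: "infinite (UNIV :: 'u set)" and E: "fully_invariant_congruence E"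
  shows "identities (models E :: 'u monoid set) = E"
proof
  show "E \<subseteq> identities (models E :: 'u monoid set)"
    by (auto simp: identities_def models_def)
  show "identities (models E :: 'u monoid set) \<subseteq> E"
  proof
    fix e assume "e \<in> identities (models E :: 'u monoid set)"
    then have "models E \<subseteq> (models {e} :: 'u monoid set)"
      by (auto simp: identities_def models_def)
    then have sub: "models E \<subseteq> (models {e} :: nat list monoid set)"
      by (rule models_subset_universe[OF inf])
    obtain u v where e: "e = (u, v)" by force
    have equiv: "equiv UNIV E"
      and ctxt: "\<And>p q u v. (u, v) \<in> E \<Longrightarrow> (p @ u @ q, p @ v @ q) \<in> E"
      and inv: "\<And>\<sigma> u v. (u, v) \<in> E \<Longrightarrow> (subst \<sigma> u, subst \<sigma> v) \<in> E"
      using E by (auto simp: fully_invariant_congruence_def)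
    have E_refl: "(w, w) \<in> E" for w
      using equiv by (auto simp: equiv_def refl_on_def)
    have E_sym: "(w, w') \<in> E \<Longrightarrow> (w', w) \<in> E" for w w'
      using equiv by (auto simp: equiv_def sym_def)
    have E_trans: "(w, w') \<in> E \<Longrightarrow> (w', w'') \<in> E \<Longrightarrow> (w, w'') \<in> E" for w w' w''
      using equiv by (meson equivE transD)
    define r where "r w = (SOME w'. (w, w') \<in> E)" for w
    have r: "(w, r w) \<in> E" for w
      unfolding r_def by (rule someI[of _ w]) (rule E_refl)
    have r_eq: "r w = r w' \<longleftrightarrow> (w, w') \<in> E" for w w'
    proof
      show "(w, w') \<in> E" if "r w = r w'"
        using r[of w] r[of w'] that E_sym E_trans by metis
      show "r w = r w'" if "(w, w') \<in> E"
      proof -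
        have "(w, z) \<in> E \<longleftrightarrow> (w', z) \<in> E" for z
          using that E_sym E_trans by blast
        then show ?thesis by (simp add: r_def)
      qed
    qed
    have r_left: "r (p @ r w @ q) = r (p @ w @ q)" for p q w
      using r_eq ctxt[OF E_sym[OF r]] by blast
    have r1: "r (r w) = r w" "r (r w @ q) = r (w @ q)" "r (p @ r w) = r (p @ w)" for p q w
      using r_left[of "[]" w "[]"] r_left[of "[]" w q] r_left[of p w "[]"] by simp_all
    define F where "F = \<lparr>carrier = range r, mult = (\<lambda>a b. r (a @ b)), one = r []\<rparr>"
    have F: "monoid F"
      by (rule monoidI) (auto simp: F_def r1)
    have val: "word_value F \<psi> w = r (subst \<psi> w)" for \<psi> w
      by (induction w) (simp_all add: F_def r1)
    have "satisfies F d" if "d \<in> E" for d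
      using that inv[of "fst d" "snd d"] by (auto simp: satisfies_def val r_eq)
    with F sub have "satisfies F e" by (auto simp: models_def)
    then have "word_value F (\<lambda>x. r [x]) u = word_value F (\<lambda>x. r [x]) v"
      by (auto simp: satisfies_def e F_def image_subset_iff)
    moreover have "r (subst (\<lambda>x. r [x]) w) = r w" for w
    proof (induction w)
      case (Cons x w)
      have "r (subst (\<lambda>x. r [x]) (x # w)) = r (r [x] @ subst (\<lambda>x. r [x]) w)"
        by simp
      also have "\<dots> = r ([x] @ r (subst (\<lambda>x. r [x]) w))"
        by (simp only: r1)
      also have "\<dots> = r ([x] @ w)" unfolding Cons by (simp only: r1)
      finally show ?case by simp
    qed simp
    ultimately show "e \<in> E" by (simp add: val r_eq e)
  qed
qed

lemma variety_eq_models_identities: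
  "monoid_variety V \<Longrightarrow> V = models (identities V)"
  by (auto simp: monoid_variety_def models_def identities_def)

lemma identities_variety_join:
  fixes V W :: "'u monoid set"
  assumes "monoid_variety V" "monoid_variety W"
  shows "identities (variety_join V W) = identities V \<inter> identities W"
proof
  show "identities (variety_join V W) \<subseteq> identities V \<inter> identities W"
    using variety_join_least(2)[OF assms] by (auto simp: identities_def)
  show "identities V \<inter> identities W \<subseteq> identities (variety_join V W)"
    unfolding identities_def variety_join_def models_def by blast
qed

text \<open>
  A symmetric relation that already respects contexts and substitutions needs only
  chains to become a fully invariant congruence, so consequences of identities can be
  analysed one replacement at a time.
\<close>

lemma fully_invariant_rtrancl:
  assumes sym: "sym R"
    and ctxt: "\<And>p q u v. (u, v) \<in> R \<Longrightarrow> (p @ u @ q, p @ v @ q) \<in> R"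
    and inv: "\<And>\<sigma> u v. (u, v) \<in> R \<Longrightarrow> (subst \<sigma> u, subst \<sigma> v) \<in> R"
  shows "fully_invariant_congruence (R\<^sup>*)"
  unfolding fully_invariant_congruence_def
proof (intro conjI allI impI)
  show "equiv UNIV (R\<^sup>*)"
    by (rule equivI) (auto simp: refl_rtrancl trans_rtrancl sym_rtrancl sym)
next
  fix p q u v assume "(u, v) \<in> R\<^sup>*"
  then show "(p @ u @ q, p @ v @ q) \<in> R\<^sup>*"
    by induction (auto intro: rtrancl_into_rtrancl ctxt)
next
  fix \<sigma> u v assume "(u, v) \<in> R\<^sup>*"
  then show "(subst \<sigma> u, subst \<sigma> v) \<in> R\<^sup>*"
    by induction (auto intro: rtrancl_into_rtrancl inv)
qed

lemma identities_Int:
  fixes V W :: "'u monoid set"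
  assumes inf: "infinite (UNIV :: 'u set)" and V: "monoid_variety V" and W: "monoid_variety W"
  shows "identities (V \<inter> W) = (identities V \<union> identities W)\<^sup>*"
proof -
  let ?R = "identities V \<union> identities W"
  have mon: "monoid M" if "M \<in> V \<union> W" for M
    using that V W by (auto simp: monoid_variety_def models_def)
  have fic: "fully_invariant_congruence (identities V)" "fully_invariant_congruence (identities W)"
    by (auto intro!: fully_invariant_identities mon)
  have E: "fully_invariant_congruence (?R\<^sup>*)"
  proof (rule fully_invariant_rtrancl)
    show "sym ?R" using fic
      by (auto simp: fully_invariant_congruence_def equiv_def intro: sym_Un)
  qed (use fic in \<open>auto simp: fully_invariant_congruence_def\<close>)
  have "models (?R\<^sup>*) \<subseteq> V \<inter> W"
  proof -
    have "models (?R\<^sup>*) \<subseteq> models (identities V)" "models (?R\<^sup>*) \<subseteq> models (identities W)"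
      by (auto simp: models_def)
    then show ?thesis
      using variety_eq_models_identities[OF V] variety_eq_models_identities[OF W] by blast
  qed
  moreover have "V \<inter> W \<subseteq> models (?R\<^sup>*)"
  proof
    fix M assume M: "M \<in> V \<inter> W"
    have "satisfies M (u, v)" if "(u, v) \<in> ?R\<^sup>*" for u v
      using that M by induction (auto simp: identities_def satisfies_def)
    with M mon show "M \<in> models (?R\<^sup>*)" by (auto simp: models_def)
  qed
  ultimately have "V \<inter> W = models (?R\<^sup>*)" by blast
  then show ?thesis using identities_models[OF inf E] by simp
qed

text \<open>
  This is what makes varieties defined by balanced identities overcommutative.
\<close>

lemma (in comm_monoid) satisfies_balanced:
  assumes "mset u = mset v"
  shows "satisfies G (u, v)"
  unfolding satisfies_def
proof (intro allI impI)
  fix \<phi> :: "nat \<Rightarrow> 'a" assume \<phi>: "range \<phi> \<subseteq> carrier G"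
  then have cl: "\<phi> x \<in> carrier G" for x by auto
  have "word_value G \<phi> u = word_value G \<phi> v" using assms
  proof (induction u arbitrary: v)
    case (Cons x u)
    then have "x \<in> set v" by (metis list.set_intros(1) mset_eq_setD)
    then obtain a b where v: "v = a @ x # b" by (auto dest: split_list)
    then have "word_value G \<phi> u = word_value G \<phi> (a @ b)"
      using Cons by simp
    then show ?case
      by (simp add: v word_value_append[OF \<phi>] m_lcomm cl \<phi>)
  qed simp
  then show "word_value G \<phi> (fst (u, v)) = word_value G \<phi> (snd (u, v))" by simp
qed

section \<open>Words that rewrite only within their own level\<close>

text \<open>
  The middle block \<open>1 0 1\<close> forces a substitution to preserve lengths of blocks of zeros, and the
  block \<open>0\<^sup>i\<^sup>+\<^sup>3\<close> encodes the level. The summand 3 guarantees that zeros outnumber the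
  three ones on every level, including level 0.
\<close>

definition level_word :: "nat \<Rightarrow> nat \<Rightarrow> nat list"
  where "level_word i k =
    replicate k 0 @ 1 # replicate (i + 3) 0 @ 1 # 0 # 1 # replicate (i - k) 0"

lemma mset_level_word:
  "k \<le> i \<Longrightarrow> l \<le> i \<Longrightarrow> mset (level_word i k) = mset (level_word i l)"
  by (simp add: level_word_def multiset_eq_iff)

lemma replicate_sep_eq_iff:
  "replicate a (0::nat) @ 1 # xs = replicate b 0 @ 1 # ys \<longleftrightarrow> a = b \<and> xs = ys"
proof (induction a arbitrary: b)
  case 0
  then show ?case by (cases b) auto
next
  case (Suc a)
  then show ?case by (cases b) auto
qed

lemma level_word_inj: "level_word i k = level_word i l \<Longrightarrow> k = l"
  by (simp add: level_word_def replicate_sep_eq_iff del: One_nat_def)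

lemma zero_word: "set w \<subseteq> {0, 1} \<Longrightarrow> count_list w 1 = 0 \<Longrightarrow> w = replicate (length w) (0::nat)"
  by (induction w) (auto split: if_splits)

lemma one_word:
  assumes "set w \<subseteq> {0, 1}" "count_list w 1 = (1::nat)"
  obtains a b where "w = replicate a (0::nat) @ 1 # replicate b 0"
proof -
  have "1 \<in> set w" using assms(2) by (metis count_notin zero_neq_one)
  then obtain x y where w: "w = x @ 1 # y" by (auto dest: split_list)
  then have "x = replicate (length x) 0" "y = replicate (length y) 0"
    using assms by (auto intro!: zero_word)
  then show ?thesis using that w by metis
qed

lemma concat_replicate_replicate: "concat (replicate a (replicate b x)) = replicate (a * b) x"
  by (induction a) (simp_all add: replicate_add)

lemma count_concat_replicate: "count_list (concat (replicate n w)) x = n * count_list w x"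
  by (induction n) auto

lemma mset_subst: "mset (subst \<sigma> w) = (\<Sum>x\<in>#mset w. mset (\<sigma> x))"
  by (induction w) auto

text \<open>
  A substitution instance of a level word inside a level word has only three ones at its
  disposal. As there are at least four zeros, \<open>\<sigma> 0\<close> contains no letter 1 and is a
  power \<open>0\<^sup>s\<close>. If \<open>s = 0\<close>, or if \<open>\<sigma> 1\<close> contains no letter 1 either, then \<open>\<sigma> 0\<close> and \<open>\<sigma> 1\<close> commute
  and the replacement changes nothing. Otherwise \<open>\<sigma> 1 = 0\<^sup>a 1 0\<^sup>b\<close>, and comparing the
  single zero of the block \<open>1 0 1\<close> gives \<open>b + s + a = 1\<close>, so \<open>\<sigma>\<close> is the identity on both letters;
  comparing the remaining blocks yields equal levels and empty contexts.
\<close>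

lemma level_word_step:
  assumes ik: "k \<le> i" "l \<le> i" and jm: "m \<le> j"
    and eq: "p @ subst \<sigma> (level_word i k) @ q = level_word j m"
  shows "p @ subst \<sigma> (level_word i l) @ q = level_word j m \<or>
    i = j \<and> k = m \<and> p @ subst \<sigma> (level_word i l) @ q = level_word j l"
proof -
  let ?c = "\<lambda>w. count_list w (1::nat)"
  have "?c (p @ subst \<sigma> (level_word i k) @ q) = 3"
    unfolding eq by (simp add: level_word_def count_notin)
  have cnt: "?c p + ?c q + (2 * i + 4) * ?c (\<sigma> 0) + 3 * ?c (\<sigma> 1) = 3"
  proof -
    obtain n where "i = k + n" using ik(1) le_Suc_ex by blast
    then show ?thesis
      using \<open>?c (p @ subst \<sigma> (level_word i k) @ q) = 3\<close>
      by (simp add: level_word_def count_concat_replicate algebra_simps)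
  qed
  have "set (p @ subst \<sigma> (level_word i k) @ q) \<subseteq> {0, 1}"
    unfolding eq by (auto simp: level_word_def)
  then have set: "set p \<subseteq> {0, 1}" "set q \<subseteq> {0, 1}" "set (\<sigma> 0) \<subseteq> {0, 1}" "set (\<sigma> 1) \<subseteq> {0, 1}"
    by (auto simp: level_word_def)
  have c0: "?c (\<sigma> 0) = 0"
    using cnt by (cases "?c (\<sigma> 0)") auto
  define s where "s = length (\<sigma> 0)"
  have \<sigma>0: "\<sigma> 0 = replicate s 0"
    unfolding s_def using zero_word[OF set(3) c0] .
  consider "?c (\<sigma> 1) = 0" | "s = 0" | "?c (\<sigma> 1) = 1" "s > 0" using cnt by linarith
  then show ?thesis
  proof cases
    case 1
    (* Both images are powers of 0, so only the length of the instance matters. *)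
    define t where "t = length (\<sigma> 1)"
    have \<sigma>1: "\<sigma> 1 = replicate t 0" unfolding t_def using zero_word[OF set(4) 1] .
    have "subst \<sigma> (level_word i n) = replicate (length (subst \<sigma> (level_word i n))) 0" for n
      by (rule replicate_eqI) (auto simp: level_word_def \<sigma>0 \<sigma>1[unfolded One_nat_def])
    moreover have "mset (subst \<sigma> (level_word i l)) = mset (subst \<sigma> (level_word i k))"
      unfolding mset_subst using mset_level_word ik by metis
    then have "length (subst \<sigma> (level_word i l)) = length (subst \<sigma> (level_word i k))"
      by (rule mset_eq_length)
    ultimately have "subst \<sigma> (level_word i l) = subst \<sigma> (level_word i k)"
      by metis
    then show ?thesis using eq by simp
  next
    case 2
    then have "subst \<sigma> (level_word i n) = \<sigma> 1 @ \<sigma> 1 @ \<sigma> 1" for n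
      by (simp add: level_word_def \<sigma>0 concat_replicate_replicate[of _ 0, simplified])
    then show ?thesis using eq by simp
  next
    case 3
    then have cpq: "?c p = 0" "?c q = 0" using cnt c0 by auto
    obtain a b where \<sigma>1: "\<sigma> 1 = replicate a 0 @ 1 # replicate b 0"
      using one_word[OF set(4) 3(1)] .
    define g h where "g = length p" and "h = length q"
    have p: "p = replicate g 0" and q: "q = replicate h 0"
      unfolding g_def h_def using zero_word set cpq by blast+
    have "p @ subst \<sigma> (level_word i k) @ q =
      replicate (g + k * s + a) 0 @ 1 # replicate (b + (i + 3) * s + a) 0 @ 1 #
      replicate (b + s + a) 0 @ 1 # replicate (b + (i - k) * s + h) 0"
      unfolding level_word_def p q
      by (simp add: \<sigma>0 \<sigma>1[unfolded One_nat_def] concat_replicate_replicate replicate_add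
          add_mult_distrib del: replicate_Suc)
    moreover have "level_word j m = replicate m 0 @ 1 # replicate (j + 3) 0 @ 1 #
      replicate 1 0 @ 1 # replicate (j - m) 0"
      by (simp add: level_word_def)
    ultimately have "replicate m (0::nat) @ 1 # replicate (j + 3) 0 @ 1 #
        replicate 1 0 @ 1 # replicate (j - m) 0 =
      replicate (g + k * s + a) 0 @ 1 # replicate (b + (i + 3) * s + a) 0 @ 1 #
      replicate (b + s + a) 0 @ 1 # replicate (b + (i - k) * s + h) 0"
      using eq by metis
    then have "m = g + k * s + a \<and> j + 3 = b + (i + 3) * s + a \<and> 1 = b + s + a \<and>
        replicate (j - m) (0::nat) = replicate (b + (i - k) * s + h) 0"
      unfolding replicate_sep_eq_iff .
    then have e: "g + k * s + a = m" "b + (i + 3) * s + a = j + 3" "b + s + a = 1"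
        "b + (i - k) * s + h = j - m"
      by auto
    have s1: "s = 1" "a = 0" "b = 0" using e(3) 3(2) by auto
    then have "i = j" "g = 0" "h = 0" "k = m" using e ik jm by auto
    moreover have "subst \<sigma> (level_word i l) = level_word i l"
      by (simp add: level_word_def \<sigma>0 \<sigma>1[unfolded One_nat_def] s1 concat_replicate_replicate[of _ 1, simplified])
    ultimately show ?thesis by (simp add: p q)
  qed
qed

section \<open>Metrics with values in a meet-semilattice of sets\<close>

text \<open>
  The order on values is reversed with respect to ordinary distances: larger sets mean closer
  points, intersection replaces addition, and the largest set \<open>T\<close> is the distance zero.
  Only the points below \<open>n\<close> carry information.
\<close>

definition set_metric :: "'a set set \<Rightarrow> 'a set \<Rightarrow> nat \<Rightarrow> (nat \<Rightarrow> nat \<Rightarrow> 'a set) \<Rightarrow> bool"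
  where "set_metric F T n d \<longleftrightarrow>
    (\<forall>i<n. d i i = T) \<and>
    (\<forall>i<n. \<forall>j<n. d i j \<in> F \<and> d i j = d j i) \<and>
    (\<forall>i<n. \<forall>j<n. \<forall>k<n. d i j \<inter> d j k \<subseteq> d i k)"

text \<open>
  Jonsson's extension step. Three new points \<open>n\<close>, \<open>n + 1\<close>, \<open>n + 2\<close> are put between \<open>p\<close> and \<open>q\<close>,
  and every other distance is the one measured along the new walk \<open>p\<close>, \<open>n\<close>, \<open>n + 1\<close>, \<open>n + 2\<close>, \<open>q\<close> from
  its nearer end. The condition \<open>A \<inter> B \<subseteq> d p q\<close> makes both ends give the same distance to the
  middle point, and keeps the old distances unchanged.
\<close>

lemma set_metric_extend:
  assumes d: "set_metric F T n d"
    and T: "T \<in> F" "\<And>A. A \<in> F \<Longrightarrow> A \<subseteq> T" and Int: "\<And>A B. A \<in> F \<Longrightarrow> B \<in> F \<Longrightarrow> A \<inter> B \<in> F"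
    and AB: "A \<in> F" "B \<in> F" and pq: "p < n" "q < n" "A \<inter> B \<subseteq> d p q"
  shows "\<exists>d'. set_metric F T (n + 3) d' \<and> (\<forall>i<n. \<forall>j<n. d' i j = d i j) \<and>
    d' p n = A \<and> d' n (n + 1) = B \<and> d' (n + 1) (n + 2) = A \<and> d' (n + 2) q = B"
proof -
  have dF: "d i j \<in> F" "d i j = d j i" "d i i = T" if "i < n" "j < n" for i j
    using d that by (auto simp: set_metric_def)
  have tri: "d i j \<inter> d j k \<subseteq> d i k" if "i < n" "j < n" "k < n" for i j k
    using d that by (auto simp: set_metric_def)
  (* Distances from the new point n + x to an old point, and between new points. The sums 1
     and 3 single out the pairs {0, 1} and {1, 2} of neighbours. *)
  define near where "near x i = (if x = 0 then d p i \<inter> A else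
      if x = 1 then d p i \<inter> A \<inter> B else d q i \<inter> B)" for x i :: nat
  define new where "new x y = (if x = y then T else if x + y = 1 then B
      else if x + y = 3 then A else A \<inter> B)" for x y :: nat
  define d' where "d' x y = (if x < n then if y < n then d x y else near (y - n) x
      else if y < n then near (x - n) y else new (x - n) (y - n))" for x y
  have three: "x = 0 \<or> x = 1 \<or> x = 2" if "x < 3" for x :: nat using that by auto
  have AT: "A \<subseteq> T" "B \<subseteq> T" using AB T by auto
  have tpq: "d p i \<inter> A \<inter> B \<subseteq> d q i" "d q i \<inter> A \<inter> B \<subseteq> d p i" if "i < n" for i
    using that pq tri[of p q i] tri[of q p i] dF(2)[of p q] by blast+
  have near_F: "near x i \<in> F" if "i < n" for x i
    using that pq AB Int dF(1) by (simp add: near_def)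
  have new_F: "new x y \<in> F" for x y
    using T(1) AB Int by (simp add: new_def)
  have new_sym: "new x y = new y x" for x y by (simp add: new_def add.commute)
  have near_old: "near x i \<inter> d i j \<subseteq> near x j" if "i < n" "j < n" for x i j
    using that pq tri[of p i j] tri[of q i j] by (auto simp: near_def)
  have near_near: "near x i \<inter> near x j \<subseteq> d i j" if "i < n" "j < n" for x i j
    using that pq tri[of i p j] tri[of i q j] dF(2)[of i p] dF(2)[of i q]
    by (auto simp: near_def)
  have near_new: "near x i \<inter> new x y \<subseteq> near y i" if "i < n" "x < 3" "y < 3" for x y i
    using three[OF that(2)] three[OF that(3)] tpq[OF that(1)]
    by (elim disjE) (simp_all add: near_def new_def, blast+)
  have near_meet: "near x i \<inter> near y i \<subseteq> new x y" if "i < n" "x < 3" "y < 3" for x y i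
    using three[OF that(2)] three[OF that(3)] AT
    by (elim disjE) (simp_all add: near_def new_def, blast+)
  have new_tri: "new x y \<inter> new y z \<subseteq> new x z" if "x < 3" "y < 3" "z < 3" for x y z
    using three[OF that(1)] three[OF that(2)] three[OF that(3)] AT
    by (elim disjE) (simp_all add: new_def, blast+)
  have "set_metric F T (n + 3) d'"
    unfolding set_metric_def
  proof (intro conjI allI impI)
    fix x show "d' x x = T" if "x < n + 3" by (simp add: d'_def new_def dF)
  next
    fix x y assume "x < n + 3" "y < n + 3"
    then show "d' x y \<in> F" by (simp add: d'_def dF near_F new_F)
    show "d' x y = d' y x" using dF(2)[of x y] by (simp add: d'_def new_sym)
  next
    fix x y z assume x: "x < n + 3" and y: "y < n + 3" and z: "z < n + 3"
    have new_pt: "w - n < 3" if "w < n + 3" for w :: nat using that by auto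
    note xyz = new_pt[OF x] new_pt[OF y] new_pt[OF z]
    show "d' x y \<inter> d' y z \<subseteq> d' x z"
    proof (cases "x < n"; cases "y < n"; cases "z < n")
      assume "x < n" "y < n" "z < n"
      then show ?thesis using tri by (simp add: d'_def)
    next
      assume "x < n" "y < n" "\<not> z < n"
      then show ?thesis using near_old[of y x "z - n"] dF(2)[of x y] by (auto simp: d'_def)
    next
      assume "x < n" "\<not> y < n" "z < n"
      then show ?thesis using near_near by (simp add: d'_def)
    next
      assume "x < n" "\<not> y < n" "\<not> z < n"
      then show ?thesis using near_new xyz by (simp add: d'_def)
    next
      assume "\<not> x < n" "y < n" "z < n"
      then show ?thesis using near_old by (simp add: d'_def)
    next
      assume "\<not> x < n" "y < n" "\<not> z < n"
      then show ?thesis using near_meet xyz by (simp add: d'_def)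
    next
      assume "\<not> x < n" "\<not> y < n" "z < n"
      then show ?thesis using near_new[of z "y - n" "x - n"] xyz new_sym by (auto simp: d'_def)
    next
      assume "\<not> x < n" "\<not> y < n" "\<not> z < n"
      then show ?thesis using new_tri xyz by (simp add: d'_def)
    qed
  qed
  moreover have "d' p n = A" "d' (n + 2) q = B"
    using pq AT dF(3) by (auto simp: d'_def near_def)
  ultimately show ?thesis
    by (intro exI[of _ d']) (simp add: d'_def new_def)
qed

text \<open>
  All walk problems are solved one after another. Stage \<open>t\<close> treats the problem with code
  \<open>t\<close>, where \<open>t\<close> encodes the two end points and the index of a pair of values; the end points are
  at most \<open>t\<close> and hence already present among the \<open>3 * t + 1\<close> points of that stage. Each problem is thus
  met exactly once, and a solution is never spoilt because old distances do not change.
\<close>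

lemma universal_set_metric:
  assumes F: "countable F" and T: "T \<in> F" "\<And>A. A \<in> F \<Longrightarrow> A \<subseteq> T"
    and Int: "\<And>A B. A \<in> F \<Longrightarrow> B \<in> F \<Longrightarrow> A \<inter> B \<in> F"
  obtains d :: "nat \<Rightarrow> nat \<Rightarrow> 'a set"
  where "\<And>n. set_metric F T n d"
    and "\<And>A B p q. A \<in> F \<Longrightarrow> B \<in> F \<Longrightarrow> A \<inter> B \<subseteq> d p q \<Longrightarrow>
      \<exists>x y z. d p x = A \<and> d x y = B \<and> d y z = A \<and> d z q = B"
proof -
  define C where "C = from_nat_into (F \<times> F)"
  have C: "fst (C c) \<in> F \<and> snd (C c) \<in> F" for c
  proof -
    have "C c \<in> F \<times> F"
      unfolding C_def by (rule from_nat_into) (use T in blast)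
    then show ?thesis by (simp add: mem_Times_iff)
  qed
  have C_surj: "\<exists>c. C c = (A, B)" if "A \<in> F" "B \<in> F" for A B
    using from_nat_into_surj[of "F \<times> F" "(A, B)"] F that by (auto simp: C_def)
  define solves where "solves n p q A B d' \<longleftrightarrow>
    d' p n = A \<and> d' n (n + 1) = B \<and> d' (n + 1) (n + 2) = A \<and> d' (n + 2) q = B"
    for n p q :: nat and A B :: "'a set" and d'
  define stage where "stage t d d' \<longleftrightarrow> (\<forall>i<3*t+1. \<forall>j<3*t+1. d' i j = d i j) \<and>
    (\<forall>p q c. t = prod_encode (p, prod_encode (q, c)) \<longrightarrow> fst (C c) \<inter> snd (C c) \<subseteq> d p q \<longrightarrow>
      solves (3*t+1) p q (fst (C c)) (snd (C c)) d')"
    for t and d d' :: "nat \<Rightarrow> nat \<Rightarrow> 'a set"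
  have "\<exists>f. \<forall>t. set_metric F T (3*t+1) (f t) \<and> stage t (f t) (f (Suc t))"
  proof (rule dependent_nat_choice)
    show "\<exists>d. set_metric F T (3*0+1) d"
      using T by (intro exI[of _ "\<lambda>_ _. T"]) (simp add: set_metric_def)
  next
    fix d t assume d: "set_metric F T (3*t+1) d"
    obtain p q c where t: "t = prod_encode (p, prod_encode (q, c))"
      by (metis prod.exhaust prod_decode_inverse)
    have pq: "p < 3*t+1" "q < 3*t+1"
      using le_prod_encode_1[of p "prod_encode (q, c)"] le_prod_encode_1[of q c]
        le_prod_encode_2[of "prod_encode (q, c)" p] t by linarith+
    have uniq: "t = prod_encode (p', prod_encode (q', c')) \<longleftrightarrow> p' = p \<and> q' = q \<and> c' = c" for p' q' c'
      by (auto simp: t prod_encode_eq)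
    have "\<exists>d'. set_metric F T (3*t+1+3) d' \<and> (\<forall>i<3*t+1. \<forall>j<3*t+1. d' i j = d i j) \<and>
      (fst (C c) \<inter> snd (C c) \<subseteq> d p q \<longrightarrow> solves (3*t+1) p q (fst (C c)) (snd (C c)) d')"
    proof (cases "fst (C c) \<inter> snd (C c) \<subseteq> d p q")
      case True
      then show ?thesis unfolding solves_def
        using set_metric_extend[OF d T Int _ _ pq True] C by blast
    next
      case False
      (* There is no problem to solve, but three points are added to keep the count. *)
      have "d p p = T" using d pq by (simp add: set_metric_def)
      then show ?thesis
        using set_metric_extend[OF d T Int T(1) T(1) pq(1) pq(1)] False by auto
    qed
    then show "\<exists>d'. set_metric F T (3*Suc t+1) d' \<and> stage t d d'"
      unfolding stage_def uniq by (simp add: algebra_simps)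
  qed
  then obtain f where f: "\<And>t. set_metric F T (3*t+1) (f t)" and st: "\<And>t. stage t (f t) (f (Suc t))"
    by blast
  have stable: "f (t + s) i j = f t i j" if "i < 3*t+1" "j < 3*t+1" for s t i j
  proof (induction s)
    case (Suc s)
    have "f (Suc (t + s)) i j = f (t + s) i j"
      using st[of "t + s"] that by (simp add: stage_def)
    then show ?case using Suc by simp
  qed simp
  define d where "d i j = f (max i j) i j" for i j
  have df: "f t i j = d i j" if "i < 3*t+1" "j < 3*t+1" for t i j
  proof (cases "max i j \<le> t")
    case True
    then show ?thesis using stable[of i "max i j" j "t - max i j"] by (simp add: d_def)
  next
    case False
    then have "t + (max i j - t) = max i j" by linarith
    then show ?thesis using stable[OF that, of "max i j - t"] by (simp only: d_def)
  qed
  have "set_metric F T n d" for n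
    unfolding set_metric_def
  proof (intro conjI allI impI)
    fix i j k assume ij: "i < n" "j < n" "k < n"
    have "d i j = f n i j" "d j k = f n j k" "d i k = f n i k" using ij df by simp_all
    then show "d i j \<inter> d j k \<subseteq> d i k" using f[of n] ij by (simp add: set_metric_def)
  next
    fix i j assume ij: "i < n" "j < n"
    have "d i j = f n i j" "d j i = f n j i" using ij df by simp_all
    then show "d i j \<in> F" "d i j = d j i" using f[of n] ij by (simp_all add: set_metric_def)
  next
    fix i assume "i < n"
    then show "d i i = T" using f[of n] df[of i n i] by (simp add: set_metric_def)
  qed
  moreover have "\<exists>x y z. d p x = A \<and> d x y = B \<and> d y z = A \<and> d z q = B"
    if AB: "A \<in> F" "B \<in> F" "A \<inter> B \<subseteq> d p q" for A B p q
  proof -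
    obtain c where c: "C c = (A, B)" using C_surj AB by blast
    define t where "t = prod_encode (p, prod_encode (q, c))"
    have pq: "p < 3*t+1" "q < 3*t+1"
      using le_prod_encode_1[of p "prod_encode (q, c)"] le_prod_encode_1[of q c]
        le_prod_encode_2[of "prod_encode (q, c)" p] t_def by linarith+
    have "A \<inter> B \<subseteq> f t p q" using AB(3) df[OF pq] by simp
    then have "solves (3*t+1) p q A B (f (Suc t))"
      using st[of t] c by (auto simp: stage_def t_def)
    then have "solves (3*t+1) p q A B d"
      using pq by (simp add: solves_def df)
    then show ?thesis by (auto simp: solves_def)
  qed
  ultimately show ?thesis using that by blast
qed

section \<open>Sublattices as lattices\<close>

lemma sublattice_lattice:
  assumes L: "lattice L" and S: "sublattice S L"
  shows "lattice (L\<lparr>carrier := S\<rparr>)"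
    and "\<And>x y. x \<in> S \<Longrightarrow> y \<in> S \<Longrightarrow> x \<squnion>\<^bsub>L\<lparr>carrier := S\<rparr>\<^esub> y = x \<squnion>\<^bsub>L\<^esub> y"
    and "\<And>x y. x \<in> S \<Longrightarrow> y \<in> S \<Longrightarrow> x \<sqinter>\<^bsub>L\<lparr>carrier := S\<rparr>\<^esub> y = x \<sqinter>\<^bsub>L\<^esub> y"
proof -
  interpret L: lattice L by fact
  let ?K = "L\<lparr>carrier := S\<rparr>"
  have SL: "x \<in> carrier L" if "x \<in> S" for x using S that by (auto simp: sublattice_def)
  have cl: "x \<squnion>\<^bsub>L\<^esub> y \<in> S" "x \<sqinter>\<^bsub>L\<^esub> y \<in> S" if "x \<in> S" "y \<in> S" for x y
    using S that by (auto simp: sublattice_def)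
  have K: "partial_order ?K"
  proof unfold_locales
    show "(.=\<^bsub>?K\<^esub>) = (=)" using L.eq_is_equal by simp
  qed (auto simp: L.eq_is_equal SL intro: L.le_trans L.le_antisym)
  have sup: "least ?K (x \<squnion>\<^bsub>L\<^esub> y) (Upper ?K {x, y})" if "x \<in> S" "y \<in> S" for x y
    using that SL cl by (auto simp: least_def Upper_def L.join_left L.join_right L.join_le)
  have inf: "greatest ?K (x \<sqinter>\<^bsub>L\<^esub> y) (Lower ?K {x, y})" if "x \<in> S" "y \<in> S" for x y
    using that SL cl by (auto simp: greatest_def Lower_def L.meet_left L.meet_right L.meet_le)
  show lat: "lattice ?K"
  proof (intro lattice.intro upper_semilattice.intro lower_semilattice.intro
      upper_semilattice_axioms.intro lower_semilattice_axioms.intro K)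
    fix x y assume "x \<in> carrier ?K" "y \<in> carrier ?K"
    then have "x \<in> S" "y \<in> S" by simp_all
    then show "\<exists>s. least ?K s (Upper ?K {x, y})" "\<exists>s. greatest ?K s (Lower ?K {x, y})"
      using sup inf by blast+
  qed
  interpret K: lattice ?K by (rule lat)
  show "x \<squnion>\<^bsub>?K\<^esub> y = x \<squnion>\<^bsub>L\<^esub> y" if "x \<in> S" "y \<in> S" for x y
    unfolding join_def[of ?K] sup_def[of ?K]
    by (rule some_equality) (use sup[OF that] K.least_unique in blast)+
  show "x \<sqinter>\<^bsub>?K\<^esub> y = x \<sqinter>\<^bsub>L\<^esub> y" if "x \<in> S" "y \<in> S" for x y
    unfolding meet_def[of ?K] inf_def[of ?K]
    by (rule some_equality) (use inf[OF that] K.greatest_unique in blast)+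
qed


section \<open>Varieties realising a lattice element\<close>

text \<open>
  The two halves bound the relation induced on the levels from above and, in the limit, from
  below. The upper bound also demands that level words are identified only with words of
  their own level, so that chains of identities starting at a level word never leave the level.
  Membership \<open>a \<in> d k l\<close> stands for \<open>a \<sqsubseteq> d k l\<close>, as distances are given as down-sets.
\<close>

definition realizes :: "(nat \<Rightarrow> nat \<Rightarrow> 'l set) \<Rightarrow> 'l \<Rightarrow> 'u monoid set \<Rightarrow> bool"
  where "realizes d a V \<longleftrightarrow>
    (\<forall>i k v. k \<le> i \<longrightarrow> (level_word i k, v) \<in> identities V \<longrightarrow>
      (\<exists>l\<le>i. v = level_word i l \<and> a \<in> d k l)) \<and>
    (\<forall>k l. a \<in> d k l \<longrightarrow>
      (\<forall>\<^sub>F i in sequentially. (level_word i k, level_word i l) \<in> identities V))"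

lemma realizes_identityD:
  assumes "realizes d a V" "k \<le> i" "(level_word i k, v) \<in> identities V"
  obtains l where "l \<le> i" "v = level_word i l" "a \<in> d k l"
  using assms unfolding realizes_def by blast

lemma realizes_eventually:
  "realizes d a V \<Longrightarrow> a \<in> d k l \<Longrightarrow>
    \<forall>\<^sub>F i in sequentially. (level_word i k, level_word i l) \<in> identities V"
  by (simp add: realizes_def)

locale lattice_metric = lattice L for L (structure) +
  fixes d :: "nat \<Rightarrow> nat \<Rightarrow> 'a set"
  assumes principal: "\<exists>c\<in>carrier L. d k l = {x \<in> carrier L. x \<sqsubseteq> c}"
    and refl: "d k k = carrier L"
    and sym: "d k l = d l k"
    and triangle: "d j k \<inter> d k l \<subseteq> d j l"
    and path: "a \<in> carrier L \<Longrightarrow> b \<in> carrier L \<Longrightarrow> a \<sqinter> b \<in> d k l \<Longrightarrow> \<exists>x y z.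
      d k x = {c \<in> carrier L. c \<sqsubseteq> a} \<and> d x y = {c \<in> carrier L. c \<sqsubseteq> b} \<and>
      d y z = {c \<in> carrier L. c \<sqsubseteq> a} \<and> d z l = {c \<in> carrier L. c \<sqsubseteq> b}"
begin

lemma down_closed: "a \<in> d k l \<Longrightarrow> b \<in> carrier L \<Longrightarrow> b \<sqsubseteq> a \<Longrightarrow> b \<in> d k l"
  using principal[of k l] by (auto intro: le_trans)

lemma meet_mem:
  assumes "a \<in> carrier L" "b \<in> carrier L" "a \<in> d k l \<or> b \<in> d k l"
  shows "a \<sqinter> b \<in> d k l"
  using assms down_closed meet_left meet_right by (metis meet_closed)

lemma join_mem_iff:
  assumes "a \<in> carrier L" "b \<in> carrier L"
  shows "a \<squnion> b \<in> d k l \<longleftrightarrow> a \<in> d k l \<and> b \<in> d k l"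
proof
  show "a \<in> d k l \<and> b \<in> d k l" if "a \<squnion> b \<in> d k l"
    using that assms down_closed join_left join_right by blast
  show "a \<squnion> b \<in> d k l" if "a \<in> d k l \<and> b \<in> d k l"
    using principal[of k l] that by (auto intro: join_le)
qed

text \<open>
  A point at distance exactly \<open>a\<close> from 0 separates \<open>a\<close> from the elements not below it: on high
  levels the variety identifies the two corresponding words, since it realises \<open>a\<close>, and then
  \<open>b\<close> must lie below their distance, since it realises \<open>b\<close>.
\<close>

lemma realizes_le:
  assumes a: "a \<in> carrier L" "realizes d a V" and b: "b \<in> carrier L" "realizes d b V"
  shows "b \<sqsubseteq> a"
proof -
  have "a \<sqinter> a \<in> d 0 0" using a refl by simp
  from path[OF a(1) a(1) this] obtain l where l: "d 0 l = {c \<in> carrier L. c \<sqsubseteq> a}"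
    by (elim exE conjE) (rule that)
  then have "a \<in> d 0 l" using a(1) by simp
  then have "\<forall>\<^sub>F i in sequentially. (level_word i 0, level_word i l) \<in> identities V"
    by (rule realizes_eventually[OF a(2)])
  then obtain i where "(level_word i 0, level_word i l) \<in> identities V"
    unfolding eventually_sequentially by blast
  then obtain l' where "level_word i l = level_word i l'" "b \<in> d 0 l'"
    by (rule realizes_identityD[OF b(2), rotated]) auto
  then have "b \<in> d 0 l" using level_word_inj by blast
  then show ?thesis using l by simp
qed

lemma realizes_unique:
  assumes "a \<in> carrier L" "realizes d a V" "b \<in> carrier L" "realizes d b V"
  shows "a = b"
  using assms realizes_le le_antisym by blast

lemma realizes_join:
  assumes V: "monoid_variety V" "a \<in> carrier L" "realizes d a V"
    and W: "monoid_variety W" "b \<in> carrier L" "realizes d b W"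
  shows "realizes d (a \<squnion> b) (variety_join V W)"
  unfolding realizes_def identities_variety_join[OF V(1) W(1)]
proof (intro conjI allI impI)
  fix i k v assume k: "k \<le> i" "(level_word i k, v) \<in> identities V \<inter> identities W"
  obtain l where l: "l \<le> i" "v = level_word i l" "a \<in> d k l"
    using k by (auto elim: realizes_identityD[OF V(3)])
  obtain l' where "v = level_word i l'" "b \<in> d k l'"
    using k by (auto elim: realizes_identityD[OF W(3)])
  with l have "b \<in> d k l" using level_word_inj by blast
  with l show "\<exists>l\<le>i. v = level_word i l \<and> a \<squnion> b \<in> d k l"
    using V(2) W(2) by (auto simp: join_mem_iff)
next
  fix k l assume "a \<squnion> b \<in> d k l"
  then have "a \<in> d k l" "b \<in> d k l" using V(2) W(2) by (auto simp: join_mem_iff)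
  then show "\<forall>\<^sub>F i in sequentially. (level_word i k, level_word i l) \<in> identities V \<inter> identities W"
    using realizes_eventually[OF V(3)] realizes_eventually[OF W(3)]
    by (simp add: eventually_conj)
qed

text \<open>
  Identities of the intersection are chains of identities of \<open>V\<close> and of \<open>W\<close>. By the triangle
  inequality such a chain from \<open>k\<close> reaches only points \<open>l\<close> with \<open>a \<sqinter> b \<in> d k l\<close>, and this holds
  for chains of any length, so no bound uniform in the level is required. Conversely, the walk of length four supplies a chain on every level that is high enough for
  its four steps.
\<close>

lemma realizes_meet:
  fixes V W :: "'u monoid set"
  assumes inf: "infinite (UNIV :: 'u set)"
    and V: "monoid_variety V" "a \<in> carrier L" "realizes d a V"
    and W: "monoid_variety W" "b \<in> carrier L" "realizes d b W"
  shows "realizes d (a \<sqinter> b) (V \<inter> W)"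
  unfolding realizes_def identities_Int[OF inf V(1) W(1)]
proof (intro conjI allI impI)
  fix i k v
  assume k: "k \<le> i" and "(level_word i k, v) \<in> (identities V \<union> identities W)\<^sup>*"
  from this(2) show "\<exists>l\<le>i. v = level_word i l \<and> a \<sqinter> b \<in> d k l"
  proof induction
    case base
    then show ?case using k V(2) W(2) refl by auto
  next
    case (step v w)
    then obtain l where l: "l \<le> i" "v = level_word i l" "a \<sqinter> b \<in> d k l" by blast
    have "\<exists>m\<le>i. w = level_word i m \<and> (a \<in> d l m \<or> b \<in> d l m)"
      using step.hyps(2) l(1,2) realizes_identityD[OF V(3)] realizes_identityD[OF W(3)]
      by (metis UnE)
    then obtain m where m: "m \<le> i" "w = level_word i m" "a \<sqinter> b \<in> d l m"
      using meet_mem V(2) W(2) by blast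
    then show ?case using l(3) triangle by blast
  qed
next
  fix k l assume "a \<sqinter> b \<in> d k l"
  from path[OF V(2) W(2) this] obtain x y z
    where "d k x = {c \<in> carrier L. c \<sqsubseteq> a}" "d x y = {c \<in> carrier L. c \<sqsubseteq> b}"
      "d y z = {c \<in> carrier L. c \<sqsubseteq> a}" "d z l = {c \<in> carrier L. c \<sqsubseteq> b}"
    by (elim exE conjE) (rule that)
  then have xyz: "a \<in> d k x" "b \<in> d x y" "a \<in> d y z" "b \<in> d z l"
    using V(2) W(2) by simp_all
  show "\<forall>\<^sub>F i in sequentially.
    (level_word i k, level_word i l) \<in> (identities V \<union> identities W)\<^sup>*"
    using realizes_eventually[OF V(3) xyz(1)] realizes_eventually[OF W(3) xyz(2)]
      realizes_eventually[OF V(3) xyz(3)] realizes_eventually[OF W(3) xyz(4)]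
  proof eventually_elim
    case (elim i)
    then have "(level_word i k, level_word i x) \<in> identities V \<union> identities W"
      "(level_word i x, level_word i y) \<in> identities V \<union> identities W"
      "(level_word i y, level_word i z) \<in> identities V \<union> identities W"
      "(level_word i z, level_word i l) \<in> identities V \<union> identities W"
      by simp_all
    then show ?case
      by (rule converse_rtrancl_into_rtrancl[OF _ converse_rtrancl_into_rtrancl[OF _
          converse_rtrancl_into_rtrancl[OF _ r_into_rtrancl]]])
  qed
qed

text \<open>
  One replacement by an identity between level words whose distance is above \<open>a\<close>; the
  reflexive-transitive closure is the fully invariant congruence generated by these identities.
\<close>

definition level_step :: "'a \<Rightarrow> identity set"
  where "level_step a = {(p @ subst \<sigma> (level_word i k) @ q, p @ subst \<sigma> (level_word i l) @ q) |
    p \<sigma> q i k l. k \<le> i \<and> l \<le> i \<and> a \<in> d k l}"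

lemma level_stepI:
  "k \<le> i \<Longrightarrow> l \<le> i \<Longrightarrow> a \<in> d k l \<Longrightarrow>
    (p @ subst \<sigma> (level_word i k) @ q, p @ subst \<sigma> (level_word i l) @ q) \<in> level_step a"
  unfolding level_step_def by blast

lemma level_stepE:
  assumes "(u, v) \<in> level_step a"
  obtains p \<sigma> q i k l where "u = p @ subst \<sigma> (level_word i k) @ q"
    "v = p @ subst \<sigma> (level_word i l) @ q" "k \<le> i" "l \<le> i" "a \<in> d k l"
  using assms unfolding level_step_def by blast

lemma fully_invariant_level_steps: "fully_invariant_congruence ((level_step a)\<^sup>*)"
proof (rule fully_invariant_rtrancl)
  show "sym (level_step a)"
    by (rule symI) (metis level_stepE level_stepI sym)
next
  fix p q u v assume "(u, v) \<in> level_step a"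
  then show "(p @ u @ q, p @ v @ q) \<in> level_step a"
  proof (rule level_stepE)
    fix p' \<sigma> q' i k l
    assume "u = p' @ subst \<sigma> (level_word i k) @ q'" "v = p' @ subst \<sigma> (level_word i l) @ q'"
      "k \<le> i" "l \<le> i" "a \<in> d k l"
    then show ?thesis using level_stepI[of k i l a "p @ p'" \<sigma> "q' @ q"] by simp
  qed
next
  fix \<tau> u v assume "(u, v) \<in> level_step a"
  then show "(subst \<tau> u, subst \<tau> v) \<in> level_step a"
  proof (rule level_stepE)
    fix p \<sigma> q i k l
    assume "u = p @ subst \<sigma> (level_word i k) @ q" "v = p @ subst \<sigma> (level_word i l) @ q"
      "k \<le> i" "l \<le> i" "a \<in> d k l"
    then show ?thesis
      using level_stepI[of k i l a "subst \<tau> p" "\<lambda>x. subst \<tau> (\<sigma> x)" "subst \<tau> q"]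
      by (simp add: subst_subst)
  qed
qed

lemma level_steps_level_word:
  assumes a: "a \<in> carrier L" and k: "k \<le> i" and "(level_word i k, v) \<in> (level_step a)\<^sup>*"
  shows "\<exists>l\<le>i. v = level_word i l \<and> a \<in> d k l"
  using assms(3)
proof induction
  case base
  then show ?case using k a refl by auto
next
  case (step v w)
  then obtain m where m: "m \<le> i" "v = level_word i m" "a \<in> d k m" by blast
  obtain p \<sigma> q i' k' l where r: "v = p @ subst \<sigma> (level_word i' k') @ q"
    "w = p @ subst \<sigma> (level_word i' l) @ q" "k' \<le> i'" "l \<le> i'" "a \<in> d k' l"
    using step.hyps(2) by (rule level_stepE)
  then show ?case
    using level_word_step[of k' i' l m i p \<sigma> q] m triangle[of k m l] by auto
qed

lemma realizes_models_level_steps: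
  assumes "infinite (UNIV :: 'u set)" "a \<in> carrier L"
  shows "realizes d a (models ((level_step a)\<^sup>*) :: 'u monoid set)"
  unfolding realizes_def identities_models[OF assms(1) fully_invariant_level_steps]
proof (intro conjI allI impI)
  fix k l assume kl: "a \<in> d k l"
  have "(level_word i k, level_word i l) \<in> level_step a" if "i \<ge> max k l" for i
    using level_stepI[of k i l a "[]" "\<lambda>x. [x]" "[]"] kl that by simp
  then show "\<forall>\<^sub>F i in sequentially. (level_word i k, level_word i l) \<in> (level_step a)\<^sup>*"
    unfolding eventually_sequentially using r_into_rtrancl by metis
next
  fix i k v assume "k \<le> i" "(level_word i k, v) \<in> (level_step a)\<^sup>*"
  then show "\<exists>l\<le>i. v = level_word i l \<and> a \<in> d k l"
    by (rule level_steps_level_word[OF assms(2)])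
qed

lemma overcommutative_models_level_steps:
  "overcommutative (models ((level_step a)\<^sup>*) :: 'u monoid set)"
  unfolding overcommutative_def
proof (intro subsetI)
  fix M :: "'u monoid" assume "M \<in> {M. comm_monoid M}"
  then interpret comm_monoid M by simp
  have "mset u = mset v" if "(u, v) \<in> (level_step a)\<^sup>*" for u v
    using that
  proof induction
    case (step v w)
    obtain p \<sigma> q i k l where "v = p @ subst \<sigma> (level_word i k) @ q"
      "w = p @ subst \<sigma> (level_word i l) @ q" "k \<le> i" "l \<le> i"
      using step.hyps(2) by (rule level_stepE)
    then have "mset v = mset w"
      using mset_level_word[of k i l] by (simp add: mset_subst)
    then show ?case using step.IH by simp
  qed simp
  then show "M \<in> models ((level_step a)\<^sup>*)"
    by (auto simp: models_def monoid_axioms intro: satisfies_balanced)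
qed

theorem homomorphic_image_of_sublattice_OC:
  assumes inf: "infinite (UNIV :: 'u set)" and ne: "carrier L \<noteq> {}"
  shows "\<exists>(S :: 'u monoid set set) h.
    sublattice S OC \<and> lattice_hom (OC\<lparr>carrier := S\<rparr>) L h \<and> h ` S = carrier L"
proof -
  interpret OC: lattice "OC :: 'u monoid set gorder" by (rule lattice_OC)
  define S :: "'u monoid set set"
    where "S = {V \<in> carrier OC. \<exists>a\<in>carrier L. realizes d a V}"
  define h where "h V = (THE a. a \<in> carrier L \<and> realizes d a V)" for V :: "'u monoid set"
  have h: "h V = a" if "a \<in> carrier L" "realizes d a V" for V a
    unfolding h_def using that realizes_unique by blast
  have S: "V \<in> carrier OC" "monoid_variety V" "h V \<in> carrier L" "realizes d (h V) V"
    if V: "V \<in> S" for V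
  proof -
    obtain a where "a \<in> carrier L" "realizes d a V" using V by (auto simp: S_def)
    then show "h V \<in> carrier L" "realizes d (h V) V" using h by auto
  qed (use V in \<open>auto simp: S_def\<close>)
  have join: "V \<squnion>\<^bsub>OC\<^esub> W \<in> S" "h (V \<squnion>\<^bsub>OC\<^esub> W) = h V \<squnion> h W"
    and meet: "V \<sqinter>\<^bsub>OC\<^esub> W \<in> S" "h (V \<sqinter>\<^bsub>OC\<^esub> W) = h V \<sqinter> h W"
    if V: "V \<in> S" and W: "W \<in> S" for V W
  proof -
    have "realizes d (h V \<squnion> h W) (V \<squnion>\<^bsub>OC\<^esub> W)"
      unfolding OC_join_meet[OF S(1)[OF V] S(1)[OF W]]
      by (rule realizes_join[OF S(2-4)[OF V] S(2-4)[OF W]])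
    moreover have "V \<squnion>\<^bsub>OC\<^esub> W \<in> carrier OC"
      by (rule OC.join_closed[OF S(1)[OF V] S(1)[OF W]])
    ultimately show "V \<squnion>\<^bsub>OC\<^esub> W \<in> S" "h (V \<squnion>\<^bsub>OC\<^esub> W) = h V \<squnion> h W"
      using S(3)[OF V] S(3)[OF W] by (auto simp: S_def intro!: h)
    have "realizes d (h V \<sqinter> h W) (V \<sqinter>\<^bsub>OC\<^esub> W)"
      unfolding OC_join_meet[OF S(1)[OF V] S(1)[OF W]]
      by (rule realizes_meet[OF inf S(2-4)[OF V] S(2-4)[OF W]])
    moreover have "V \<sqinter>\<^bsub>OC\<^esub> W \<in> carrier OC"
      by (rule OC.meet_closed[OF S(1)[OF V] S(1)[OF W]])
    ultimately show "V \<sqinter>\<^bsub>OC\<^esub> W \<in> S" "h (V \<sqinter>\<^bsub>OC\<^esub> W) = h V \<sqinter> h W"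
      using S(3)[OF V] S(3)[OF W] by (auto simp: S_def intro!: h)
  qed
  have surj: "\<exists>V\<in>S. h V = a" if a: "a \<in> carrier L" for a
  proof (rule bexI[of _ "models ((level_step a)\<^sup>*)"])
    show "h (models ((level_step a)\<^sup>*)) = a"
      by (rule h[OF a realizes_models_level_steps[OF inf a]])
    show "models ((level_step a)\<^sup>*) \<in> S"
      using a realizes_models_level_steps[OF inf a] overcommutative_models_level_steps
      by (auto simp: S_def monoid_variety_def)
  qed
  have sub: "sublattice S OC"
    unfolding sublattice_def using surj ne join(1) meet(1) S(1) by blast
  have "lattice L" by (rule lattice_axioms)
  then have "lattice_hom (OC\<lparr>carrier := S\<rparr>) L h"
    using sublattice_lattice[OF lattice_OC sub] join(2) meet(2) S(3)
    by (auto simp: lattice_hom_def join_pres_def meet_pres_def)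
  moreover have "h ` S = carrier L" using S(3) surj by blast
  ultimately show ?thesis using sub by blast
qed

end

text \<open>
  The principal down-sets of \<open>L\<close> are closed under intersection, and a finite lattice has a
  greatest element, so the whole carrier is one of them.
\<close>

lemma lattice_metric_exists:
  assumes L: "lattice L" and fin: "finite (carrier L)" and ne: "carrier L \<noteq> {}"
  shows "\<exists>d. lattice_metric L d"
proof -
  interpret lattice L by fact
  define down where "down a = {x \<in> carrier L. x \<sqsubseteq>\<^bsub>L\<^esub> a}" for a
  define F where "F = down ` carrier L"
  have "least L (\<Squnion>\<^bsub>L\<^esub>carrier L) (Upper L (carrier L))"
    using fin ne by (intro finite_sup_least) auto
  then obtain t where "t \<in> carrier L" "\<And>x. x \<in> carrier L \<Longrightarrow> x \<sqsubseteq>\<^bsub>L\<^esub> t"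
    unfolding least_def Upper_def by blast
  then have T: "carrier L \<in> F" by (auto simp: F_def down_def)
  have down_Int: "down a \<inter> down b = down (a \<sqinter>\<^bsub>L\<^esub> b)" if "a \<in> carrier L" "b \<in> carrier L" for a b
  proof
    show "down a \<inter> down b \<subseteq> down (a \<sqinter>\<^bsub>L\<^esub> b)" using that by (auto simp: down_def meet_le)
    show "down (a \<sqinter>\<^bsub>L\<^esub> b) \<subseteq> down a \<inter> down b"
      using that meet_left[OF that] meet_right[OF that]
      by (auto simp: down_def intro: le_trans[OF _ meet_left] le_trans[OF _ meet_right])
  qed
  have "countable F" using fin by (simp add: F_def countable_finite)
  moreover have "A \<subseteq> carrier L" if "A \<in> F" for A using that by (auto simp: F_def down_def)
  moreover have "A \<inter> B \<in> F" if "A \<in> F" "B \<in> F" for A B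
    using that by (auto simp: F_def down_Int)
  ultimately obtain d where d: "\<And>n. set_metric F (carrier L) n d"
    and path: "\<And>A B p q. A \<in> F \<Longrightarrow> B \<in> F \<Longrightarrow> A \<inter> B \<subseteq> d p q \<Longrightarrow>
      \<exists>x y z. d p x = A \<and> d x y = B \<and> d y z = A \<and> d z q = B"
    using universal_set_metric[OF _ T] by metis
  have dF: "d k l \<in> F" and dsym: "d k l = d l k" for k l
    using d[of "Suc (max k l)"] by (auto simp: set_metric_def)
  have "lattice_metric L d"
  proof (intro lattice_metric.intro lattice_metric_axioms.intro L)
    show "\<exists>c\<in>carrier L. d k l = {x \<in> carrier L. x \<sqsubseteq>\<^bsub>L\<^esub> c}" for k l
      using dF[of k l] by (auto simp: F_def down_def)
    show "d k k = carrier L" for k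
      using d[of "Suc k"] by (auto simp: set_metric_def)
    show "d k l = d l k" for k l by (rule dsym)
    show "d j k \<inter> d k l \<subseteq> d j l" for j k l
      using d[of "Suc (max j (max k l))"] by (simp add: set_metric_def)
  next
    fix a b k l assume ab: "a \<in> carrier L" "b \<in> carrier L" "a \<sqinter>\<^bsub>L\<^esub> b \<in> d k l"
    obtain c where c: "c \<in> carrier L" "d k l = down c" using dF[of k l] by (auto simp: F_def)
    have "down (a \<sqinter>\<^bsub>L\<^esub> b) \<subseteq> d k l"
      using ab c by (auto simp: down_def intro: le_trans)
    then show "\<exists>x y z. d k x = {c \<in> carrier L. c \<sqsubseteq>\<^bsub>L\<^esub> a} \<and> d x y = {c \<in> carrier L. c \<sqsubseteq>\<^bsub>L\<^esub> b} \<and>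
      d y z = {c \<in> carrier L. c \<sqsubseteq>\<^bsub>L\<^esub> a} \<and> d z l = {c \<in> carrier L. c \<sqsubseteq>\<^bsub>L\<^esub> b}"
      using path[of "down a" "down b" k l] ab down_Int by (auto simp: F_def down_def)
  qed
  then show ?thesis by blast
qed

theorem mainTheorem2:
  fixes L :: "'l gorder"
  assumes "infinite (UNIV :: 'u set)"
    and "lattice L" and "finite (carrier L)" and "carrier L \<noteq> {}"
  shows "\<exists>(S :: 'u monoid set set) h.
    sublattice S OC \<and> lattice_hom (OC\<lparr>carrier := S\<rparr>) L h \<and> h ` S = carrier L"
proof -
  obtain d where "lattice_metric L d"
    using lattice_metric_exists[OF assms(2-4)] by blast
  then show ?thesis
    using assms(1,4) by (rule lattice_metric.homomorphic_image_of_sublattice_OC)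
qed

end
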